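(* Let $C\in\Bbbk$ and let $X$ be a submultiset of $R_{u+C}$, with multiset partition $R_{u+C}=X\coprod Y$. Then the $\mathcal{S}_u$-module $A_C(X)$ is simple if and only if $(X-Y)\cap\mathbb{Z}_{\geq 1}=\emptyset$, i.e. if and only if there are no $\alpha\in Y$ and $\beta\in X$ such that $\beta-\alpha\in\mathbb{Z}_{\geq 1}$.
   Context: $\Bbbk$ is an algebraically closed field of characteristic zero. Fix a nonzero polynomial $g(h)\in\Bbbk[h]$ and a polynomial $u(h)\in\Bbbk[h]$ with $g(h)=u(h-1)-u(h)$ (such $u$ exists, is unique up to its constant term, and $\deg u=\deg g+1\geq 1$). The Smith algebra $\mathcal{S}_u$ is the unital associative $\Bbbk$-algebra generated by $x,y,h$ with defining relations $[h,y]=y$, $[h,x]=-x$, $[y,x]=g(h)$. $R_f$ denotes the multiset of roots of a nonzero polynomial $f$ (with multiplicity). Differences and unions of multisets are taken with multiplicity, so $Y=R_{u+C}\setminus X$ is the multiset complement of $X$. $X-Y=\{\beta-\alpha\mid\beta\in X,\alpha\in Y\}$. For $C\in\Bbbk$ and a submultiset $X\subseteq R_{u+C}$, put $q(h)=\prod_{\alpha\in X}(h-\alpha)$ (with multiplicity; empty product $=1$) and $p(h)=\frac{u(h-1)+C}{q(h-1)}\in\Bbbk[h]$. The module $A_C(X)$ is $\Bbbk[h]$ with $h$ acting by multiplication and $x\cdot f(h)=f(h+1)q(h)$, $y\cdot f(h)=f(h-1)p(h)$ for all $f\in\Bbbk[h]$. *)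

theory Defs
  imports
    "HOL-Computational_Algebra.Computational_Algebra"
    "HOL-Library.Poly_Mapping"
    "HOL-Algebra.QuotRing"
    "HOL-Algebra.Module"
begin

section \<open>The free algebra on three generators\<close>

datatype gen = GenX | GenY | GenH

text \<open>
  Words in the generators.  They are wrapped in a type of their own because the convolution
  product of \<^theory>\<open>HOL-Library.Poly_Mapping\<close> is taken over a monoid written
  additively: here \<open>+\<close> is concatenation, which is not commutative.
\<close>

datatype word = Word (letters: "gen list")

instantiation word :: monoid_add
begin

definition zero_word :: word where "0 = Word []"

definition plus_word :: "word \<Rightarrow> word \<Rightarrow> word" where
  "v + w = Word (letters v @ letters w)"

instance
  by standard (simp_all add: zero_word_def plus_word_def)

end

lemma letters_zero [simp]: "letters 0 = []"
  by (simp add: zero_word_def)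

lemma letters_plus [simp]: "letters (v + w) = letters v @ letters w"
  by (simp add: plus_word_def)

type_synonym 'k free_alg = "word \<Rightarrow>\<^sub>0 'k"

definition free_ring :: "'k :: field free_alg ring" where
  "free_ring = \<lparr>carrier = UNIV, mult = (*), one = 1, zero = 0, add = (+)\<rparr>"

definition gen_elt :: "gen \<Rightarrow> 'k :: field free_alg" where
  "gen_elt a = Poly_Mapping.single (Word [a]) 1"

definition eval_free :: "'k :: field poly \<Rightarrow> 'k free_alg \<Rightarrow> 'k free_alg" where
  "eval_free f F = (\<Sum>i\<le>Polynomial.degree f. Poly_Mapping.single 0 (Polynomial.coeff f i) * F ^ i)"


section \<open>The Smith algebra\<close>

definition smith_relations :: "'k :: field poly \<Rightarrow> 'k free_alg set" where
  "smith_relations g =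
     (let x = gen_elt GenX; y = gen_elt GenY; h = gen_elt GenH
      in {(h * y - y * h) - y,
          (h * x - x * h) - (- x),
          (y * x - x * y) - eval_free g h})"

definition smith_ideal :: "'k :: field poly \<Rightarrow> 'k free_alg set" where
  "smith_ideal g = genideal free_ring (smith_relations g)"

definition smith_algebra :: "'k :: field poly \<Rightarrow> 'k free_alg set ring" where
  "smith_algebra g = free_ring Quot (smith_ideal g)"


section \<open>Modules over noncommutative rings\<close>

text \<open>
  The locale \<^locale>\<open>module\<close> asks for a commutative ring of scalars.
  Its notion of \<^locale>\<open>submodule\<close> does not, and is used below.
\<close>

locale left_module = R?: ring R + M?: abelian_group M for R (structure) and M (structure) +
  assumes smult_closed:
      "\<lbrakk>a \<in> carrier R; v \<in> carrier M\<rbrakk> \<Longrightarrow> a \<odot>\<^bsub>M\<^esub> v \<in> carrier M"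
    and smult_l_distr:
      "\<lbrakk>a \<in> carrier R; b \<in> carrier R; v \<in> carrier M\<rbrakk> \<Longrightarrow>
         (a \<oplus>\<^bsub>R\<^esub> b) \<odot>\<^bsub>M\<^esub> v = a \<odot>\<^bsub>M\<^esub> v \<oplus>\<^bsub>M\<^esub> b \<odot>\<^bsub>M\<^esub> v"
    and smult_r_distr:
      "\<lbrakk>a \<in> carrier R; v \<in> carrier M; w \<in> carrier M\<rbrakk> \<Longrightarrow>
         a \<odot>\<^bsub>M\<^esub> (v \<oplus>\<^bsub>M\<^esub> w) = a \<odot>\<^bsub>M\<^esub> v \<oplus>\<^bsub>M\<^esub> a \<odot>\<^bsub>M\<^esub> w"
    and smult_assoc:
      "\<lbrakk>a \<in> carrier R; b \<in> carrier R; v \<in> carrier M\<rbrakk> \<Longrightarrow>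
         (a \<otimes>\<^bsub>R\<^esub> b) \<odot>\<^bsub>M\<^esub> v = a \<odot>\<^bsub>M\<^esub> (b \<odot>\<^bsub>M\<^esub> v)"
    and smult_one:
      "v \<in> carrier M \<Longrightarrow> \<one>\<^bsub>R\<^esub> \<odot>\<^bsub>M\<^esub> v = v"

definition simple_module ::
    "('r, 's) ring_scheme \<Rightarrow> ('r, 'm, 't) module_scheme \<Rightarrow> bool" where
  "simple_module R M \<longleftrightarrow>
     left_module R M \<and> carrier M \<noteq> {\<zero>\<^bsub>M\<^esub>} \<and>
     (\<forall>N. submodule N R M \<longrightarrow> N = {\<zero>\<^bsub>M\<^esub>} \<or> N = carrier M)"


section \<open>The modules $A_C(X)$\<close>

definition A_q :: "'k :: field multiset \<Rightarrow> 'k poly" where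
  "A_q X = (\<Prod>\<alpha>\<in>#X. [:- \<alpha>, 1:])"

text \<open>
  For \<open>X\<close> a submultiset of the roots of \<open>u + C\<close> the division is exact.
\<close>

definition A_p :: "'k :: field poly \<Rightarrow> 'k \<Rightarrow> 'k multiset \<Rightarrow> 'k poly" where
  "A_p u C X = (pcompose u [:- 1, 1:] + [:C:]) div pcompose (A_q X) [:- 1, 1:]"

fun gen_act :: "'k :: field poly \<Rightarrow> 'k \<Rightarrow> 'k multiset \<Rightarrow> gen \<Rightarrow> 'k poly \<Rightarrow> 'k poly" where
  "gen_act u C X GenX f = pcompose f [:1, 1:] * A_q X"
| "gen_act u C X GenY f = pcompose f [:- 1, 1:] * A_p u C X"
| "gen_act u C X GenH f = [:0, 1:] * f"

definition word_act :: "'k :: field poly \<Rightarrow> 'k \<Rightarrow> 'k multiset \<Rightarrow> word \<Rightarrow> 'k poly \<Rightarrow> 'k poly" where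
  "word_act u C X w f = foldr (gen_act u C X) (letters w) f"

definition free_act :: "'k :: field poly \<Rightarrow> 'k \<Rightarrow> 'k multiset \<Rightarrow> 'k free_alg \<Rightarrow> 'k poly \<Rightarrow> 'k poly" where
  "free_act u C X F f =
     (\<Sum>w\<in>Poly_Mapping.keys F. Polynomial.smult (Poly_Mapping.lookup F w) (word_act u C X w f))"

text \<open>
  A scalar is a coset \<open>S\<close> of the ideal of relations and acts through any of its
  representatives; \<open>A_module_smult\<close> below shows that the choice does not matter.
  The ring multiplication of \<open>k[h]\<close> only fills the unused fields of the record type of modules.
\<close>

definition A_module ::
    "'k :: field poly \<Rightarrow> 'k \<Rightarrow> 'k multiset \<Rightarrow> ('k free_alg set, 'k poly) module" where
  "A_module u C X =
     \<lparr>carrier = UNIV, mult = (*), one = 1, zero = 0, add = (+),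
      smult = (\<lambda>S f. free_act u C X (SOME F. F \<in> S) f)\<rparr>"

lemma free_act_superset:
  assumes "finite A" and "Poly_Mapping.keys F \<subseteq> A"
  shows "free_act u C X F f =
    (\<Sum>w\<in>A. Polynomial.smult (Poly_Mapping.lookup F w) (word_act u C X w f))"
  unfolding free_act_def
  by (rule sum.mono_neutral_left) (use assms in \<open>auto simp: in_keys_iff\<close>)

lemma free_act_add_left: "free_act u C X (F + G) f = free_act u C X F f + free_act u C X G f"
proof -
  let ?A = "Poly_Mapping.keys F \<union> Poly_Mapping.keys G"
  have "Poly_Mapping.keys (F + G) \<subseteq> ?A"
    by (rule Poly_Mapping.keys_add)
  then show ?thesis
    by (simp add: free_act_superset[of ?A] lookup_add smult_add_left sum.distrib)
qed

lemma free_act_zero_left [simp]: "free_act u C X 0 f = 0"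
  by (simp add: free_act_def)

lemma free_act_uminus_left: "free_act u C X (- F) f = - free_act u C X F f"
  using free_act_add_left[of u C X F "- F" f] by (simp add: eq_neg_iff_add_eq_0 add.commute)

lemma free_act_diff_left: "free_act u C X (F - G) f = free_act u C X F f - free_act u C X G f"
  using free_act_add_left[of u C X F "- G" f] by (simp add: free_act_uminus_left)

lemma free_act_sum_left: "free_act u C X (sum F I) f = (\<Sum>i\<in>I. free_act u C X (F i) f)"
  by (induction I rule: infinite_finite_induct) (auto simp: free_act_add_left)

lemma free_act_single [simp]:
  "free_act u C X (Poly_Mapping.single w c) f = Polynomial.smult c (word_act u C X w f)"
  by (simp add: free_act_def)

lemma gen_act_add: "gen_act u C X a (f + f') = gen_act u C X a f + gen_act u C X a f'"
  by (cases a) (simp_all add: pcompose_add algebra_simps smult_add_right)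

lemma gen_act_smult: "gen_act u C X a (Polynomial.smult c f) = Polynomial.smult c (gen_act u C X a f)"
  by (cases a) (simp_all add: pcompose_smult)

lemma word_act_add: "word_act u C X w (f + f') = word_act u C X w f + word_act u C X w f'"
proof -
  have "foldr (gen_act u C X) l (f + f') = foldr (gen_act u C X) l f + foldr (gen_act u C X) l f'" for l
    by (induction l) (simp_all add: gen_act_add)
  then show ?thesis by (simp add: word_act_def)
qed

lemma word_act_smult:
  "word_act u C X w (Polynomial.smult c f) = Polynomial.smult c (word_act u C X w f)"
proof -
  have "foldr (gen_act u C X) l (Polynomial.smult c f) =
        Polynomial.smult c (foldr (gen_act u C X) l f)" for l
    by (induction l) (simp_all add: gen_act_smult)
  then show ?thesis by (simp add: word_act_def)
qed

lemma word_act_plus: "word_act u C X (v + w) f = word_act u C X v (word_act u C X w f)"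
  by (simp add: word_act_def)

lemma word_act_zero [simp]: "word_act u C X 0 f = f"
  by (simp add: word_act_def)

lemma free_act_add_right: "free_act u C X F (f + f') = free_act u C X F f + free_act u C X F f'"
  by (simp add: free_act_def word_act_add smult_add_right sum.distrib)

lemma free_act_smult_right:
  "free_act u C X F (Polynomial.smult c f) = Polynomial.smult c (free_act u C X F f)"
proof -
  have "Polynomial.smult c (sum r A) = (\<Sum>w\<in>A. Polynomial.smult c (r w))"
    for r :: "word \<Rightarrow> 'a poly" and A
    by (induction A rule: infinite_finite_induct) (simp_all add: smult_add_right)
  then show ?thesis
    by (simp add: free_act_def word_act_smult mult.commute)
qed

lemma free_act_zero_right [simp]: "free_act u C X F 0 = 0"
  using free_act_smult_right[of u C X F 0 0] by simp

lemma free_alg_induct [case_names zero single_add]: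
  fixes F :: "'k :: field free_alg"
  assumes "P 0" and "\<And>w c F. P F \<Longrightarrow> P (Poly_Mapping.single w c + F)"
  shows "P F"
proof (induction F rule: update_induct)
  case const
  show ?case by (rule assms(1))
next
  case (update F w c)
  have "Poly_Mapping.update w c F = Poly_Mapping.single w c + F"
    using update(1) by (intro poly_mapping_eqI)
      (auto simp: lookup_update lookup_add lookup_single in_keys_iff when_def)
  then show ?case using assms(2) update by simp
qed

lemma free_act_mult: "free_act u C X (F * G) f = free_act u C X F (free_act u C X G f)"
proof (induction F rule: free_alg_induct)
  case zero
  show ?case by simp
next
  case (single_add v c F)
  have "free_act u C X (Poly_Mapping.single v c * G) f =
        Polynomial.smult c (word_act u C X v (free_act u C X G f))"
  proof (induction G rule: free_alg_induct)
    case zero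
    show ?case using word_act_smult[of u C X v 0 0] by simp
  next
    case (single_add w d G)
    then show ?case
      by (simp add: distrib_left free_act_add_left mult_single word_act_plus word_act_add
          word_act_smult smult_add_right)
  qed
  with single_add show ?case
    by (simp add: distrib_right free_act_add_left)
qed

lemma free_act_one [simp]: "free_act u C X 1 f = f"
  by (simp flip: single_one)

lemma free_act_gen [simp]: "free_act u C X (gen_elt a) f = gen_act u C X a f"
  by (simp add: gen_elt_def word_act_def)

lemma free_act_eval_free [simp]: "free_act u C X (eval_free g (gen_elt GenH)) f = g * f"
proof -
  have pow: "free_act u C X (gen_elt GenH ^ i) f = [:0, 1:] ^ i * f" for i
    by (induction i) (simp_all add: free_act_mult mult.assoc)
  have "free_act u C X (eval_free g (gen_elt GenH)) f =
        (\<Sum>i\<le>Polynomial.degree g. Polynomial.smult (Polynomial.coeff g i) ([:0, 1:] ^ i * f))"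
    by (simp add: eval_free_def free_act_sum_left free_act_mult pow)
  also have "\<dots> = (\<Sum>i\<le>Polynomial.degree g. Polynomial.monom (Polynomial.coeff g i) i) * f"
    by (simp add: sum_distrib_right monom_altdef)
  also have "\<dots> = g * f"
    by (simp add: poly_as_sum_of_monoms)
  finally show ?thesis .
qed

lemma ring_free_ring: "ring (free_ring :: 'k :: field free_alg ring)"
proof (rule ringI)
  show "abelian_group (free_ring :: 'k free_alg ring)"
  proof (rule abelian_groupI)
    fix F :: "'k free_alg"
    show "\<exists>G\<in>carrier free_ring. G \<oplus>\<^bsub>free_ring\<^esub> F = \<zero>\<^bsub>free_ring\<^esub>"
      by (rule bexI[of _ "- F"]) (simp_all add: free_ring_def)
  qed (simp_all add: free_ring_def ac_simps)
  show "monoid (free_ring :: 'k free_alg ring)"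
    by unfold_locales (simp_all add: free_ring_def ac_simps)
qed (simp_all add: free_ring_def algebra_simps)

lemma ideal_smith_ideal: "ideal (smith_ideal g) free_ring"
  unfolding smith_ideal_def
  by (rule ring.genideal_ideal[OF ring_free_ring]) (simp add: free_ring_def)

lemma ring_smith_algebra: "ring (smith_algebra g)"
  unfolding smith_algebra_def by (rule ideal.quotient_is_ring[OF ideal_smith_ideal])

lemma free_ring_a_inv: "\<ominus>\<^bsub>free_ring\<^esub> F = - (F :: 'k :: field free_alg)"
proof -
  interpret ring "free_ring :: 'k free_alg ring" by (rule ring_free_ring)
  show ?thesis
    by (rule minus_equality) (simp_all add: free_ring_def)
qed

lemma pcompose_shift [simp]:
  fixes f :: "'k :: field poly"
  shows "pcompose (pcompose f [:1, 1:]) [:- 1, 1:] = f"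
    and "pcompose (pcompose f [:- 1, 1:]) [:1, 1:] = f"
  by (simp_all flip: pcompose_assoc add: pcompose_pCons)

lemma A_q_dvd:
  assumes "X \<subseteq># proots f"
  shows "A_q X dvd f"
proof (cases "f = 0")
  case False
  then show ?thesis using assms
  proof (induction X arbitrary: f)
    case empty
    then show ?case by (simp add: A_q_def)
  next
    case (add a X)
    have "a \<in># proots f"
      using add.prems(2) by (meson mset_subset_eqD union_single_eq_member)
    then obtain r where r: "f = [:- a, 1:] * r"
      using add.prems(1) by (auto simp: poly_eq_0_iff_dvd)
    with add.prems(1) have "r \<noteq> 0"
      by auto
    then have "proots f = add_mset a (proots r)"
      using add.prems(1) unfolding r by (subst proots_mult) auto
    with add \<open>r \<noteq> 0\<close> have "A_q X dvd r"
      by simp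
    then show ?case
      unfolding r by (simp add: A_q_def mult_dvd_mono del: mult_pCons_left)
  qed
qed simp

lemma A_p_mult:
  assumes "X \<subseteq># proots (u + [:C:])"
  shows "A_p u C X * pcompose (A_q X) [:- 1, 1:] = pcompose u [:- 1, 1:] + [:C:]"
proof -
  obtain r where "u + [:C:] = A_q X * r"
    using A_q_dvd[OF assms] by blast
  then have "pcompose (u + [:C:]) [:- 1, 1:] = pcompose (A_q X) [:- 1, 1:] * pcompose r [:- 1, 1:]"
    by (simp add: pcompose_mult)
  then have "pcompose (A_q X) [:- 1, 1:] dvd pcompose u [:- 1, 1:] + [:C:]"
    by (simp add: pcompose_add)
  then show ?thesis
    by (simp add: A_p_def)
qed

lemma free_act_smith_ideal:
  fixes g u :: "'k :: field poly"
  assumes g: "g = pcompose u [:- 1, 1:] - u" and X: "X \<subseteq># proots (u + [:C:])"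
    and F: "F \<in> smith_ideal g"
  shows "free_act u C X F f = 0"
proof -
  let ?I = "{F. \<forall>f. free_act u C X F f = 0}"
  let ?p = "A_p u C X" and ?q = "A_q X"
  have pq: "?p * pcompose ?q [:- 1, 1:] = pcompose u [:- 1, 1:] + [:C:]"
    by (rule A_p_mult[OF X])
  have "pcompose (?p * pcompose ?q [:- 1, 1:]) [:1, 1:] = u + [:C:]"
    unfolding pq by (simp add: pcompose_add)
  then have qp: "pcompose ?p [:1, 1:] * ?q = u + [:C:]"
    by (simp add: pcompose_mult)
  have "ideal ?I free_ring"
  proof (rule idealI[OF ring_free_ring])
    show "subgroup ?I (add_monoid free_ring)"
    proof (rule group.subgroupI[OF abelian_group.a_group[OF ring.is_abelian_group[OF ring_free_ring]]])
      show "inv\<^bsub>add_monoid free_ring\<^esub> F \<in> ?I" if "F \<in> ?I" for F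
        using that unfolding free_ring_a_inv[unfolded a_inv_def] by (simp add: free_act_uminus_left)
    qed (auto simp: free_ring_def free_act_add_left intro: exI[of _ 0])
  qed (auto simp: free_ring_def free_act_mult)
  moreover have "smith_relations g \<subseteq> ?I"
  proof -
    have alg: "h * (a * b) - (h - 1) * a * b - a * b = 0" "h * (a * b) - (h + 1) * a * b + a * b = 0"
      for h a b :: "'k poly"
      by (simp_all add: algebra_simps)
    have "[:0, 1:] * (pcompose f [:- 1, 1:] * ?p) - pcompose ([:0, 1:] * f) [:- 1, 1:] * ?p
          - pcompose f [:- 1, 1:] * ?p = 0" for f
    proof -
      have "pcompose ([:0, 1:] * f) [:- 1, 1:] = ([:0, 1:] - 1) * pcompose f [:- 1, 1:]"
        by (simp only: pcompose_mult) (simp add: pcompose_pCons one_pCons)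
      then show ?thesis using alg by (simp only:)
    qed
    moreover have "[:0, 1:] * (pcompose f [:1, 1:] * ?q) - pcompose ([:0, 1:] * f) [:1, 1:] * ?q
          + pcompose f [:1, 1:] * ?q = 0" for f
    proof -
      have "pcompose ([:0, 1:] * f) [:1, 1:] = ([:0, 1:] + 1) * pcompose f [:1, 1:]"
        by (simp only: pcompose_mult) (simp add: pcompose_pCons one_pCons)
      then show ?thesis using alg by (simp only:)
    qed
    moreover have "pcompose (pcompose f [:1, 1:] * ?q) [:- 1, 1:] * ?p
          - pcompose (pcompose f [:- 1, 1:] * ?p) [:1, 1:] * ?q - g * f = 0" for f
    proof -
      have "pcompose (pcompose f [:1, 1:] * ?q) [:- 1, 1:] * ?p
          - pcompose (pcompose f [:- 1, 1:] * ?p) [:1, 1:] * ?q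
          = f * (?p * pcompose ?q [:- 1, 1:]) - f * (pcompose ?p [:1, 1:] * ?q)"
        by (simp add: pcompose_mult mult_ac)
      also have "\<dots> = g * f"
        unfolding pq qp g by (simp add: algebra_simps)
      finally show ?thesis by simp
    qed
    ultimately show ?thesis
      by (auto simp: smith_relations_def Let_def free_act_diff_left free_act_mult free_act_add_left
          simp del: mult_pCons_left)
  qed
  ultimately have "smith_ideal g \<subseteq> ?I"
    unfolding smith_ideal_def by (rule ring.genideal_minimal[OF ring_free_ring])
  with F show ?thesis by blast
qed

lemma smith_coset_act:
  assumes "g = pcompose u [:- 1, 1:] - u" and "X \<subseteq># proots (u + [:C:])"
  shows "smult (A_module u C X) (smith_ideal g +>\<^bsub>free_ring\<^esub> F) f = free_act u C X F f"
proof -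
  let ?S = "smith_ideal g +>\<^bsub>free_ring\<^esub> F"
  have S: "?S = {G + F |G. G \<in> smith_ideal g}"
    by (auto simp: a_r_coset_def r_coset_def free_ring_def)
  have "0 \<in> smith_ideal g"
    using additive_subgroup.zero_closed[OF ideal.axioms(1)[OF ideal_smith_ideal], of g]
    by (simp add: free_ring_def)
  then have "F \<in> ?S"
    unfolding S by force
  then have "(SOME G. G \<in> ?S) \<in> ?S"
    by (rule someI)
  then obtain G where "G \<in> smith_ideal g" and "(SOME G. G \<in> ?S) = G + F"
    unfolding S by blast
  then show ?thesis
    using free_act_smith_ideal[OF assms] by (simp add: A_module_def free_act_add_left)
qed

lemma A_module_smult:
  assumes "g = pcompose u [:- 1, 1:] - u" and "X \<subseteq># proots (u + [:C:])"
    and "S \<in> carrier (smith_algebra g)" and "F \<in> S"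
  shows "smult (A_module u C X) S f = free_act u C X F f"
proof -
  obtain G where "S = smith_ideal g +>\<^bsub>free_ring\<^esub> G"
    using assms(3) by (auto simp: smith_algebra_def FactRing_def A_RCOSETS_def')
  moreover from this obtain I where "I \<in> smith_ideal g" "F = I + G"
    using assms(4) by (auto simp: a_r_coset_def r_coset_def free_ring_def)
  ultimately show ?thesis
    using smith_coset_act[OF assms(1,2)] free_act_smith_ideal[OF assms(1,2)]
    by (simp add: free_act_add_left)
qed

theorem left_module_A_module:
  assumes g: "g = pcompose u [:- 1, 1:] - u" and X: "X \<subseteq># proots (u + [:C:])"
  shows "left_module (smith_algebra g) (A_module u C X)"
proof -
  interpret I: ideal "smith_ideal g" free_ring by (rule ideal_smith_ideal)
  let ?pr = "\<lambda>F. smith_ideal g +>\<^bsub>free_ring\<^esub> F"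
  note act = smith_coset_act[OF g X]
  have hom: "?pr \<in> ring_hom free_ring (smith_algebra g)"
    unfolding smith_algebra_def by (rule I.rcos_ring_hom)
  have add: "?pr F \<oplus>\<^bsub>smith_algebra g\<^esub> ?pr G = ?pr (F + G)" for F G
    using ring_hom_add[OF hom, of F G] by (simp add: free_ring_def)
  have mult: "?pr F \<otimes>\<^bsub>smith_algebra g\<^esub> ?pr G = ?pr (F * G)" for F G
    using ring_hom_mult[OF hom, of F G] by (simp add: free_ring_def)
  have one: "\<one>\<^bsub>smith_algebra g\<^esub> = ?pr 1"
    using ring_hom_one[OF hom] by (simp add: free_ring_def)
  have repr: "\<exists>F. S = ?pr F" if "S \<in> carrier (smith_algebra g)" for S
    using that by (auto simp: smith_algebra_def FactRing_def A_RCOSETS_def')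
  have ab: "abelian_group (A_module u C X)"
  proof (rule abelian_groupI)
    fix f
    show "\<exists>f'\<in>carrier (A_module u C X). f' \<oplus>\<^bsub>A_module u C X\<^esub> f = \<zero>\<^bsub>A_module u C X\<^esub>"
      by (rule bexI[of _ "- f"]) (simp_all add: A_module_def)
  qed (simp_all add: A_module_def ac_simps)
  have A: "carrier (A_module u C X) = UNIV" "add (A_module u C X) = (+)"
    by (simp_all add: A_module_def)
  show ?thesis
  proof (intro left_module.intro left_module_axioms.intro ring_smith_algebra ab)
    show "\<one>\<^bsub>smith_algebra g\<^esub> \<odot>\<^bsub>A_module u C X\<^esub> f = f" for f
      by (simp add: one act)
  qed (auto dest!: repr simp: A add mult act free_act_add_left free_act_add_right free_act_mult)
qed

end

theory Submission
  imports Defs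
begin

text \<open>
  Write \<open>u + C = a q r\<close> with \<open>a\<close> the leading coefficient and \<open>q\<close>, \<open>r\<close> the monic polynomials
  with root multisets \<open>X\<close> and \<open>Y\<close>.  Since \<open>h\<close> acts by multiplication, a submodule of
  \<open>A_C(X)\<close> is an ideal of \<open>k[h]\<close> that is stable under
  \<open>f(h) \<mapsto> f(h+1) q(h)\<close> and \<open>f(h) \<mapsto> f(h-1) r(h-1)\<close>
  (\<open>submodule_A_module_iff\<close>, \<open>A_p_eq\<close>).

  Consider the set \<open>Z\<close> of common zeros of such an ideal.  If \<open>\<gamma> \<in> Z\<close> then stability under
  \<open>x\<close> says that \<open>\<gamma> + 1 \<in> Z\<close> unless \<open>\<gamma>\<close> is a root of \<open>q\<close>, and stability under \<open>y\<close> says that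
  \<open>\<gamma> - 1 \<in> Z\<close> unless \<open>\<gamma> - 1\<close> is a root of \<open>r\<close>.  For a nonzero proper ideal, \<open>Z\<close> is finite and
  nonempty, so the string \<open>\<gamma> + \<int>\<close> leaves \<open>Z\<close> in both directions: upwards it does so after some
  \<open>\<beta> \<in> X\<close>, downwards it arrives at some \<open>\<alpha> \<in> Y\<close>.  Then \<open>\<beta> - \<alpha>\<close> is a positive integer
  (\<open>root_gap_of_stable_ideal\<close>).

  Conversely, if \<open>\<beta> = \<alpha> + n\<close> with \<open>n \<ge> 1\<close>, such a \<open>Z\<close> can be filled in: the principal ideal
  generated by \<open>\<Prod>\<^sub>i (h - \<alpha> - i)\<close>, \<open>1 \<le> i \<le> n\<close>, is stable, because a shift of the
  generator loses only the one end factor that \<open>q\<close> or \<open>r(h-1)\<close> puts back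
  (\<open>gap_poly_dvd_up\<close>, \<open>gap_poly_dvd_down\<close>).
\<close>

section \<open>The polynomials $q$ and $p$\<close>

lemma poly_A_q_eq_0_iff: "poly (A_q X) c = 0 \<longleftrightarrow> c \<in># X"
  by (induction X) (auto simp: A_q_def)

lemma A_q_union: "A_q (X + Y) = A_q X * A_q Y"
  by (simp add: A_q_def)

lemma A_q_nonzero: "A_q X \<noteq> 0"
  by (auto simp: A_q_def)

lemma proots_A_q: "proots (A_q X) = X"
proof (induction X)
  case (add \<alpha> X)
  have "A_q (add_mset \<alpha> X) = [:- \<alpha>, 1:] * A_q X"
    by (simp add: A_q_def)
  then have "proots (A_q (add_mset \<alpha> X)) = proots [:- \<alpha>, 1:] + proots (A_q X)"
    by (simp only:) (rule proots_mult, simp_all add: A_q_nonzero)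
  with add show ?case by simp
qed (simp add: A_q_def)

lemma alg_closed_eq_smult_A_q:
  fixes f :: "'k :: alg_closed_field poly"
  assumes "f \<noteq> 0"
  shows "f = Polynomial.smult (lead_coeff f) (A_q (proots f))"
proof -
  obtain A where A: "f = Polynomial.smult (lead_coeff f) (A_q A)"
    using alg_closed_imp_factorization[OF assms] by (auto simp: A_q_def)
  have "proots f = A"
    using assms by (subst A) (simp add: proots_A_q)
  then show ?thesis
    using A by simp
qed

text \<open>
  The quotient defining \<open>p\<close> cancels the factors from \<open>X\<close> and so leaves the shifted
  factors from \<open>Y\<close>, up to a unit.
\<close>

lemma A_p_eq:
  fixes u :: "'k :: alg_closed_field poly"
  assumes nz: "u + [:C:] \<noteq> 0" and XY: "proots (u + [:C:]) = X + Y"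
  shows "A_p u C X =
    Polynomial.smult (lead_coeff (u + [:C:])) (pcompose (A_q Y) [:- 1, 1:])"
proof -
  let ?a = "lead_coeff (u + [:C:])" and ?s = "[:- 1, 1:] :: 'k poly"
  have "u + [:C:] = Polynomial.smult ?a (A_q X * A_q Y)"
    using alg_closed_eq_smult_A_q[OF nz] by (simp add: XY A_q_union)
  then have "pcompose (u + [:C:]) ?s
      = pcompose (Polynomial.smult ?a (A_q X * A_q Y)) ?s"
    by (rule arg_cong)
  then have u: "pcompose u ?s + [:C:]
      = Polynomial.smult ?a (pcompose (A_q Y) ?s) * pcompose (A_q X) ?s"
    by (simp add: pcompose_add pcompose_mult pcompose_smult mult.commute)
  have "pcompose (A_q X) ?s \<noteq> 0"
    by (simp add: pcompose_eq_0_iff A_q_nonzero)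
  then show ?thesis
    unfolding A_p_def u by (rule nonzero_mult_div_cancel_right)
qed


section \<open>Submodules as stable ideals\<close>

text \<open>
  An element of the Smith algebra acts through any representative in the free algebra, so a
  submodule is a subspace stable under the generators.  Closure under all of \<open>k[h]\<close>, which
  also covers the scalars and negation, comes from the elements \<open>eval_free p h\<close>.
\<close>

lemma submodule_A_module_iff:
  assumes g: "g = pcompose u [:- 1, 1:] - u" and X: "X \<subseteq># proots (u + [:C:])"
  shows "submodule N (smith_algebra g) (A_module u C X) \<longleftrightarrow>
     0 \<in> N \<and> (\<forall>f\<in>N. \<forall>f'\<in>N. f + f' \<in> N) \<and> (\<forall>f\<in>N. \<forall>p. p * f \<in> N) \<and>
     (\<forall>f\<in>N. pcompose f [:1, 1:] * A_q X \<in> N \<and> pcompose f [:- 1, 1:] * A_p u C X \<in> N)"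
    (is "?sub \<longleftrightarrow> ?stable")
proof
  assume ?sub
  then interpret N: submodule N "smith_algebra g" "A_module u C X" .
  have act: "free_act u C X F f \<in> N" if "f \<in> N" for F f
  proof -
    have "smith_ideal g +>\<^bsub>free_ring\<^esub> F \<in> carrier (smith_algebra g)"
      by (auto simp: smith_algebra_def FactRing_def A_RCOSETS_def' free_ring_def)
    from N.smult_closed[OF this that] show ?thesis
      by (simp add: smith_coset_act[OF g X])
  qed
  have "p * f \<in> N" if "f \<in> N" for p f
    using act[OF that, of "eval_free p (gen_elt GenH)"] by simp
  moreover have "gen_act u C X a f \<in> N" if "f \<in> N" for a f
    using act[OF that, of "gen_elt a"] by simp
  from this[of _ GenX] this[of _ GenY]
  have "pcompose f [:1, 1:] * A_q X \<in> N \<and> pcompose f [:- 1, 1:] * A_p u C X \<in> N"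
    if "f \<in> N" for f
    using that by simp
  ultimately show ?stable
    using N.one_closed N.m_closed by (simp add: A_module_def)
next
  interpret M: left_module "smith_algebra g" "A_module u C X"
    by (rule left_module_A_module[OF g X])
  assume st: ?stable
  then have ideal: "p * f \<in> N" if "f \<in> N" for p f
    using that by blast
  have gen: "gen_act u C X a f \<in> N" if "f \<in> N" for a f
  proof (cases a)
    case GenH
    show ?thesis
      unfolding GenH gen_act.simps by (rule ideal[OF that])
  qed (use st that in auto)
  have "foldr (gen_act u C X) l f \<in> N" if "f \<in> N" for l f
    using that by (induction l) (simp_all add: gen)
  then have word: "Polynomial.smult c (word_act u C X w f) \<in> N" if "f \<in> N" for w c f
    using ideal[of _ "[:c:]"] that by (simp add: word_act_def)
  have act: "free_act u C X F f \<in> N" if "f \<in> N" for F f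
    by (induction F rule: free_alg_induct) (use st word that in \<open>simp_all add: free_act_add_left\<close>)
  show ?sub
  proof (intro submodule.intro submodule_axioms.intro)
    show "S \<odot>\<^bsub>A_module u C X\<^esub> f \<in> N"
      if "S \<in> carrier (smith_algebra g)" and "f \<in> N" for S f
      using that act
      by (auto simp: smith_algebra_def FactRing_def A_RCOSETS_def'
          smith_coset_act[OF g X, unfolded smith_algebra_def])
    show "subgroup N (add_monoid (A_module u C X))"
    proof (rule M.add.subgroupI)
      show "\<ominus>\<^bsub>A_module u C X\<^esub> f \<in> N" if "f \<in> N" for f
      proof -
        have "\<ominus>\<^bsub>A_module u C X\<^esub> f = - f"
          by (rule M.minus_equality) (simp_all add: A_module_def)
        then show ?thesis
          using ideal[OF that, of "- 1"] by simp
      qed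
    qed (use st in \<open>auto simp: A_module_def\<close>)
  qed
qed

lemma simple_module_A_module_iff:
  assumes g: "g = pcompose u [:- 1, 1:] - u" and X: "X \<subseteq># proots (u + [:C:])"
  shows "simple_module (smith_algebra g) (A_module u C X) \<longleftrightarrow>
    (\<forall>N. submodule N (smith_algebra g) (A_module u C X) \<longrightarrow> N = {0} \<or> N = UNIV)"
proof -
  have "UNIV \<noteq> {0 :: 'a poly}"
    by (metis UNIV_I singletonD zero_neq_one)
  then show ?thesis
    using left_module_A_module[OF g X] by (simp add: simple_module_def) (simp add: A_module_def)
qed


section \<open>A gap between roots produces a submodule\<close>

text \<open>
  With \<open>\<beta> = \<alpha> + n\<close>, the zeros leave out \<open>\<alpha>\<close> but include \<open>\<beta>\<close>: a step up is stopped by a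
  root of \<open>q\<close> at its starting point, a step down by a root of \<open>r\<close> at its end point.
\<close>

definition gap_poly :: "'k :: field \<Rightarrow> nat \<Rightarrow> 'k poly" where
  "gap_poly \<alpha> n = (\<Prod>i<n. [:- (\<alpha> + of_nat (Suc i)), 1:])"

lemma gap_poly_nonzero: "gap_poly \<alpha> n \<noteq> 0"
  by (simp add: gap_poly_def)

lemma gap_poly_Suc: "gap_poly \<alpha> (Suc n) = gap_poly \<alpha> n * [:- (\<alpha> + of_nat (Suc n)), 1:]"
  by (simp add: gap_poly_def)

lemma gap_poly_Suc_shift:
  "gap_poly \<alpha> (Suc n) = [:- (\<alpha> + 1), 1:] * gap_poly (\<alpha> + 1) n"
  unfolding gap_poly_def by (subst prod.lessThan_Suc_shift) (simp add: add_ac)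

lemma gap_poly_shift:
  "pcompose (gap_poly \<alpha> n) [:- c, 1:] = gap_poly (\<alpha> + c) n"
  by (simp add: gap_poly_def pcompose_prod pcompose_pCons algebra_simps)

text \<open>
  A shift by one step moves the string of roots \<open>\<alpha> + 1, \<dots>, \<alpha> + n + 1\<close> by one place, so it still
  has all of them except the one at an end; the second factor supplies that root.
\<close>

lemma gap_poly_dvd_up:
  assumes "poly q (\<alpha> + of_nat (Suc n)) = 0"
  shows "gap_poly \<alpha> (Suc n) dvd pcompose (gap_poly \<alpha> (Suc n)) [:1, 1:] * q"
proof -
  have "pcompose (gap_poly \<alpha> (Suc n)) [:1, 1:] = [:- \<alpha>, 1:] * gap_poly \<alpha> n"
    using gap_poly_shift[of \<alpha> "Suc n" "- 1"] gap_poly_Suc_shift[of "\<alpha> - 1" n] by simp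
  then have "gap_poly \<alpha> n dvd pcompose (gap_poly \<alpha> (Suc n)) [:1, 1:]"
    by (simp only: dvd_triv_right)
  moreover have "[:- (\<alpha> + of_nat (Suc n)), 1:] dvd q"
    using assms poly_eq_0_iff_dvd by blast
  ultimately show ?thesis
    unfolding gap_poly_Suc[of \<alpha>] by (rule mult_dvd_mono)
qed

lemma gap_poly_dvd_down:
  assumes "poly p (\<alpha> + 1) = 0"
  shows "gap_poly \<alpha> (Suc n) dvd pcompose (gap_poly \<alpha> (Suc n)) [:- 1, 1:] * p"
proof -
  have "gap_poly (\<alpha> + 1) n dvd pcompose (gap_poly \<alpha> (Suc n)) [:- 1, 1:]"
    by (subst gap_poly_shift, subst gap_poly_Suc) (rule dvd_triv_left)
  moreover have "[:- (\<alpha> + 1), 1:] dvd p"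
    using assms poly_eq_0_iff_dvd by blast
  ultimately show ?thesis
    unfolding gap_poly_Suc_shift by (subst mult.commute) (rule mult_dvd_mono)
qed

lemma gap_poly_not_dvd_1: "\<not> gap_poly \<alpha> (Suc n) dvd 1"
proof
  assume "gap_poly \<alpha> (Suc n) dvd 1"
  moreover have "[:- (\<alpha> + 1), 1:] dvd gap_poly \<alpha> (Suc n)"
    unfolding gap_poly_Suc_shift by (rule dvd_triv_left)
  ultimately have "[:- (\<alpha> + 1), 1:] dvd 1"
    by (rule dvd_trans[rotated])
  then show False
    by (simp add: is_unit_iff_degree)
qed

text \<open>
  Applied to the multiples of a single polynomial, stability is divisibility of the two images
  of the generator, because both shifts are ring homomorphisms.
\<close>

lemma submodule_dvd:
  assumes g: "g = pcompose u [:- 1, 1:] - u" and X: "X \<subseteq># proots (u + [:C:])"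
    and up: "d dvd pcompose d [:1, 1:] * A_q X"
    and down: "d dvd pcompose d [:- 1, 1:] * A_p u C X"
  shows "submodule {f. d dvd f} (smith_algebra g) (A_module u C X)"
proof -
  have shift: "d dvd pcompose f s * t" if "d dvd f" and "d dvd pcompose d s * t" for f s t
  proof -
    obtain k where "f = d * k"
      using \<open>d dvd f\<close> ..
    then have "pcompose f s * t = pcompose k s * (pcompose d s * t)"
      by (simp add: pcompose_mult mult_ac)
    with that(2) show ?thesis by (simp only: dvd_mult)
  qed
  show ?thesis
    unfolding submodule_A_module_iff[OF g X] using shift up down by auto
qed


section \<open>A proper submodule produces a gap between roots\<close>

lemma proper_ideal_common_root:
  fixes N :: "'k :: alg_closed_field poly set"
  assumes "0 \<in> N" and add: "\<And>f f'. f \<in> N \<Longrightarrow> f' \<in> N \<Longrightarrow> f + f' \<in> N"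
    and mult: "\<And>f p. f \<in> N \<Longrightarrow> p * f \<in> N"
    and "N \<noteq> {0}" and "N \<noteq> UNIV"
  obtains z where "\<And>f. f \<in> N \<Longrightarrow> poly f z = 0"
proof -
  \<comment> \<open>A nonzero element of least degree divides all of \<open>N\<close>.\<close>
  obtain d0 where "d0 \<in> N" "d0 \<noteq> 0"
    using assms(1,4) by blast
  then obtain d where d: "d \<in> N" "d \<noteq> 0"
    and min: "\<And>f. f \<in> N \<Longrightarrow> f \<noteq> 0 \<Longrightarrow> Polynomial.degree d \<le> Polynomial.degree f"
    using ex_has_least_nat[of "\<lambda>d. d \<in> N \<and> d \<noteq> 0" d0 Polynomial.degree] by blast
  have dvd: "d dvd f" if "f \<in> N" for f
  proof -
    have "f mod d = f + (- (f div d)) * d"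
      using div_mult_mod_eq[of f d] by (simp add: algebra_simps)
    also have "\<dots> \<in> N"
      using add mult that d(1) by blast
    finally have "f mod d \<in> N" .
    then have "f mod d = 0"
      using min[of "f mod d"] degree_mod_less[OF d(2), of f] by fastforce
    then show ?thesis by (simp add: mod_eq_0_iff_dvd)
  qed
  have "\<not> d dvd 1"
  proof
    assume "d dvd 1"
    then have "f \<in> N" for f
      using mult[OF d(1), of "f div d"] by (metis dvd_div_mult_self dvd_trans one_dvd)
    with \<open>N \<noteq> UNIV\<close> show False by blast
  qed
  then have "Polynomial.degree d > 0"
    using d(2) is_unit_iff_degree by blast
  then obtain z where "poly d z = 0"
    using alg_closed_imp_poly_has_root by blast
  with dvd have "poly f z = 0" if "f \<in> N" for f
    using dvd[OF that] by (auto elim!: dvdE)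
  then show ?thesis using that by blast
qed

text \<open>In characteristic zero an arithmetic progression is infinite, so it has to leave \<open>Z\<close>.\<close>

lemma finite_set_last_step:
  fixes z s :: "'k :: field_char_0"
  assumes "finite Z" and "z \<in> Z" and "s \<noteq> 0"
  obtains m :: nat where "z + of_nat m * s \<in> Z" and "z + of_nat m * s + s \<notin> Z"
proof (rule ccontr)
  assume *: "\<not> thesis"
  have "z + of_nat m * s \<in> Z" for m
  proof (induction m)
    case (Suc m)
    then have "z + of_nat m * s + s \<in> Z"
      using that * by blast
    then show ?case by (simp add: algebra_simps)
  qed (use assms in simp)
  then have "range (\<lambda>m. z + of_nat m * s) \<subseteq> Z"
    by blast
  moreover have "inj (\<lambda>m :: nat. z + of_nat m * s)"
    using \<open>s \<noteq> 0\<close> by (auto intro!: injI)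
  ultimately show False
    using \<open>finite Z\<close> finite_subset finite_imageD infinite_UNIV_nat by blast
qed

text \<open>
  The common zeros of the ideal on one string \<open>\<gamma> + \<int>\<close> can only end upwards at a root of \<open>q\<close>
  and downwards just above a root of \<open>p(h+1)\<close>.
\<close>

lemma root_gap_of_stable_ideal:
  fixes N :: "'k :: {alg_closed_field, field_char_0} poly set"
  assumes "0 \<in> N" and "\<And>f f'. f \<in> N \<Longrightarrow> f' \<in> N \<Longrightarrow> f + f' \<in> N"
    and "\<And>f p. f \<in> N \<Longrightarrow> p * f \<in> N"
    and "N \<noteq> {0}" and "N \<noteq> UNIV"
    and up: "\<And>f. f \<in> N \<Longrightarrow> pcompose f [:1, 1:] * q \<in> N"
    and down: "\<And>f. f \<in> N \<Longrightarrow> pcompose f [:- 1, 1:] * p \<in> N"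
  obtains \<alpha> and n :: nat where "poly p (\<alpha> + 1) = 0" and "poly q (\<alpha> + of_nat (Suc n)) = 0"
proof -
  define Z where "Z = {z. \<forall>f\<in>N. poly f z = 0}"
  obtain f0 where "f0 \<in> N" "f0 \<noteq> 0"
    using assms(1,4) by blast
  then have "finite Z"
    using finite_subset[of Z "{z. poly f0 z = 0}"] poly_roots_finite[of f0] by (auto simp: Z_def)
  obtain z where "\<And>f. f \<in> N \<Longrightarrow> poly f z = 0"
    using proper_ideal_common_root[OF assms(1-5)] by blast
  then have z: "z \<in> Z"
    by (simp add: Z_def)
  obtain m where m: "z + of_nat m * 1 \<in> Z" "z + of_nat m * 1 + 1 \<notin> Z"
    by (rule finite_set_last_step[OF \<open>finite Z\<close> z one_neq_zero])
  obtain k where k: "z + of_nat k * (- 1) \<in> Z" "z + of_nat k * (- 1) + (- 1) \<notin> Z"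
    by (rule finite_set_last_step[OF \<open>finite Z\<close> z, of "- 1"]) auto
  have "poly q (z + of_nat m) = 0"
  proof -
    obtain f where "f \<in> N" "poly f (z + of_nat m + 1) \<noteq> 0"
      using m(2) by (auto simp: Z_def)
    moreover have "poly (pcompose f [:1, 1:] * q) (z + of_nat m) = 0"
      using m(1) up[OF \<open>f \<in> N\<close>] unfolding Z_def mult_1_right by blast
    ultimately show ?thesis
      by (simp add: poly_pcompose add_ac)
  qed
  moreover have "poly p (z - of_nat k) = 0"
  proof -
    obtain f where "f \<in> N" "poly f (z - of_nat k - 1) \<noteq> 0"
      using k(2) by (auto simp: Z_def)
    moreover have "poly (pcompose f [:- 1, 1:] * p) (z - of_nat k) = 0"
      using k(1) down[OF \<open>f \<in> N\<close>] unfolding Z_def mult_minus1_right add_uminus_conv_diff by blast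
    ultimately show ?thesis
      by (simp add: poly_pcompose algebra_simps)
  qed
  ultimately show ?thesis
    using that[of "z - of_nat k - 1" "m + k"] by (simp add: algebra_simps)
qed


section \<open>The simplicity criterion\<close>

lemma mem_of_int_ge_1_iff:
  "c \<in> (of_int ` {1..} :: 'k :: ring_char_0 set) \<longleftrightarrow> (\<exists>n. c = of_nat (Suc n))"
proof
  assume "c \<in> of_int ` {1..}"
  then obtain i :: int where "c = of_int i" "i \<ge> 1"
    by auto
  then have "c = of_nat (Suc (nat (i - 1)))"
    by (simp flip: of_nat_Suc add: Suc_nat_eq_nat_zadd1)
  then show "\<exists>n. c = of_nat (Suc n)" ..
next
  assume "\<exists>n. c = of_nat (Suc n)"
  then obtain n where "c = of_int (int (Suc n))"
    by auto
  then show "c \<in> of_int ` {1..}"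
    by (rule image_eqI) simp
qed

lemma simple_A_module_iff_no_gap:
  fixes u :: "'k :: {alg_closed_field, field_char_0} poly"
  assumes nz: "u + [:C:] \<noteq> 0" and g: "g = pcompose u [:- 1, 1:] - u"
    and XY: "proots (u + [:C:]) = X + Y"
  shows "simple_module (smith_algebra g) (A_module u C X) \<longleftrightarrow>
    \<not> (\<exists>\<alpha> n. \<alpha> \<in># Y \<and> \<alpha> + of_nat (Suc n) \<in># X)"
proof -
  have X: "X \<subseteq># proots (u + [:C:])"
    by (simp add: XY)
  have p0: "poly (A_p u C X) (\<alpha> + 1) = 0 \<longleftrightarrow> \<alpha> \<in># Y" for \<alpha>
    using nz by (simp add: A_p_eq[OF nz XY] poly_pcompose poly_A_q_eq_0_iff del: coeff_add)
  note q0 = poly_A_q_eq_0_iff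
  note simple = simple_module_A_module_iff[OF g X]
  show ?thesis
  proof
    assume "simple_module (smith_algebra g) (A_module u C X)"
    moreover have "\<exists>N. submodule N (smith_algebra g) (A_module u C X) \<and> N \<noteq> {0} \<and> N \<noteq> UNIV"
      if "\<alpha> \<in># Y" and "\<alpha> + of_nat (Suc n) \<in># X" for \<alpha> n
    proof (intro exI conjI)
      let ?N = "{f. gap_poly \<alpha> (Suc n) dvd f}"
      show "submodule ?N (smith_algebra g) (A_module u C X)"
        using that by (intro submodule_dvd[OF g X] gap_poly_dvd_up gap_poly_dvd_down)
          (simp_all only: p0 q0)
      show "?N \<noteq> {0}"
        using gap_poly_nonzero[of \<alpha> "Suc n"] dvd_refl by blast
      show "?N \<noteq> UNIV"
        using gap_poly_not_dvd_1[of \<alpha> n] by blast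
    qed
    ultimately show "\<not> (\<exists>\<alpha> n. \<alpha> \<in># Y \<and> \<alpha> + of_nat (Suc n) \<in># X)"
      unfolding simple by blast
  next
    assume no_gap: "\<not> (\<exists>\<alpha> n. \<alpha> \<in># Y \<and> \<alpha> + of_nat (Suc n) \<in># X)"
    have "N = {0} \<or> N = UNIV" if "submodule N (smith_algebra g) (A_module u C X)" for N
    proof (rule ccontr)
      assume proper: "\<not> (N = {0} \<or> N = UNIV)"
      note stable = that[unfolded submodule_A_module_iff[OF g X]]
      obtain \<alpha> n where "poly (A_p u C X) (\<alpha> + 1) = 0"
        and "poly (A_q X) (\<alpha> + of_nat (Suc n)) = 0"
        by (rule root_gap_of_stable_ideal[of N "A_q X" "A_p u C X"])
          (use stable proper in blast)+
      with no_gap show False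
        unfolding p0 q0 by blast
    qed
    then show "simple_module (smith_algebra g) (A_module u C X)"
      unfolding simple by blast
  qed
qed

theorem corollary3p18:
  fixes g u :: "'k :: {alg_closed_field, field_char_0} poly"
    and C :: 'k
    and X Y :: "'k multiset"
  assumes "g \<noteq> 0"
    and "g = pcompose u [:- 1, 1:] - u"
    and "proots (u + [:C:]) = X + Y"
  shows "(simple_module (smith_algebra g) (A_module u C X) \<longleftrightarrow>
            {\<beta> - \<alpha> |\<alpha> \<beta>. \<beta> \<in># X \<and> \<alpha> \<in># Y} \<inter> of_int ` {1..} = {})
       \<and> (simple_module (smith_algebra g) (A_module u C X) \<longleftrightarrow>
            \<not> (\<exists>\<alpha> \<beta>. \<alpha> \<in># Y \<and> \<beta> \<in># X \<and> \<beta> - \<alpha> \<in> of_int ` {1..}))"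
proof -
  have "u + [:C:] \<noteq> 0"
  proof
    assume "u + [:C:] = 0"
    then have "u = [:- C:]"
      by (simp add: eq_neg_iff_add_eq_0[symmetric])
    with assms(1,2) show False by simp
  qed
  note criterion = simple_A_module_iff_no_gap[OF this assms(2,3)]
  have "(\<exists>\<alpha> n. \<alpha> \<in># Y \<and> \<alpha> + of_nat (Suc n) \<in># X) \<longleftrightarrow>
      (\<exists>\<alpha> \<beta>. \<alpha> \<in># Y \<and> \<beta> \<in># X \<and> \<beta> - \<alpha> \<in> of_int ` {1..})"
    unfolding mem_of_int_ge_1_iff diff_eq_eq by (auto simp only: add.commute)
  then have "simple_module (smith_algebra g) (A_module u C X) \<longleftrightarrow>
      \<not> (\<exists>\<alpha> \<beta>. \<alpha> \<in># Y \<and> \<beta> \<in># X \<and> \<beta> - \<alpha> \<in> of_int ` {1..})"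
    by (simp only: criterion)
  then show ?thesis by blast
qed

end
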